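(* Let $q\ge3$ be a prime power, let $\mathbb{F}_q(x)$ be the rational function field over $\mathbb{F}_q$ and let $t=\frac{q^2-q}{2}$. Denote by $P_1^2,\ldots,P_t^2$ the $t$ places of degree $2$ of $\mathbb{F}_q(x)$, and by $P_\infty$ the place at infinity. Let $\mathrm{RS}_q(3,2)$ be a Reed-Solomon code of dimension $2$ evaluating at $3$ distinct elements of $\mathbb{F}_q$. Then the generalized algebraic-geometric code $$\mathcal{C}=C\bigl(P_1^2,\ldots,P_t^2:(q^2-q-2)P_\infty:\mathrm{RS}_q(3,2),\ldots,\mathrm{RS}_q(3,2)\bigr)$$ is a linear code over $\mathbb{F}_q$ of length $\frac32(q^2-q)$, dimension $q^2-q-1$ and minimum distance $3$, with locality $2$, and it reaches the Singleton-like bound for locally recoverable codes, i.e. its parameters $n,k,d$ and $r=2$ satisfy $d=n-k-\left\lceil\frac{k}{r}\right\rceil+2$.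
   Context: The degree-2 places $P_1^2,\ldots,P_t^2$ of $\mathbb{F}_q(x)$ correspond to the monic irreducible polynomials $p_1,\ldots,p_t$ of degree 2 over $\mathbb{F}_q$. The Riemann-Roch space $\mathcal{L}(mP_\infty)$ is the space of polynomials in $\mathbb{F}_q[x]$ of degree at most $m$. Reed-Solomon code: for distinct $\alpha_1,\alpha_2,\alpha_3\in\mathbb{F}_q$, $\mathrm{RS}_q(3,2)=\{(h(\alpha_1),h(\alpha_2),h(\alpha_3)) : h\in\mathbb{F}_q[x],\ \deg h<2\}$. Explicit form of $\mathcal{C}$: the residue class field of $P_i^2$ is $\mathbb{F}_q[x]/(p_i)$, identified with $\mathbb{F}_q[x]_{<2}$ (polynomials of degree less than 2) by taking remainders modulo $p_i$; its elements are encoded by $\mathrm{RS}_q(3,2)$ by evaluating the remainder at $\alpha_1,\alpha_2,\alpha_3$. Thus $\mathcal{C}\subset\mathbb{F}_q^{3t}$ is the image of the map sending $f\in\mathbb{F}_q[x]$ with $\deg f\le q^2-q-2$ to the concatenation over $i=1,\ldots,t$ of $(f_i(\alpha_1),f_i(\alpha_2),f_i(\alpha_3))$, where $f_i$ is the remainder of $f$ modulo $p_i$. Locality: a linear code $\mathcal{C}\subset\mathbb{F}_q^n$ has locality $r$ if for each $1\le i\le n$ there is a set $N_i\subset\{1,\ldots,n\}\smallsetminus\{i\}$ with $|N_i|\le r$ such that, for all $c\in\mathcal{C}$, $c_i$ is determined by $(c_j)_{j\in N_i}$. The Singleton-like bound states that a linear code of length $n$, dimension $k$, minimum distance $d$ with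 locality $r$ satisfies $d\le n-k-\lceil k/r\rceil+2$. *)

theory Defs
  imports "Jordan_Normal_Form.VS_Connect"
begin

section \<open>Linear codes of length \<open>n\<close> over a field\<close>

definition linear_code :: "nat \<Rightarrow> 'a::field vec set \<Rightarrow> bool" where
  "linear_code n C \<longleftrightarrow> VectorSpace.subspace class_ring C (module_vec TYPE('a) n)"

definition code_dim :: "nat \<Rightarrow> 'a::field vec set \<Rightarrow> nat" where
  "code_dim n C = vectorspace.dim class_ring ((module_vec TYPE('a) n)\<lparr>carrier := C\<rparr>)"

definition hamming_dist :: "'a vec \<Rightarrow> 'a vec \<Rightarrow> nat" where
  "hamming_dist u v = card {i. i < dim_vec u \<and> u $ i \<noteq> v $ i}"

definition min_dist :: "'a vec set \<Rightarrow> nat" where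
  "min_dist C = Min {hamming_dist u v | u v. u \<in> C \<and> v \<in> C \<and> u \<noteq> v}"

text \<open>Coordinates are numbered from \<open>0\<close>.  That \<open>c $ i\<close> is determined by the coordinates of \<open>c\<close> in
  \<open>N\<close> is expressed by comparing two codewords that agree on \<open>N\<close>.\<close>

definition has_locality :: "nat \<Rightarrow> 'a vec set \<Rightarrow> nat \<Rightarrow> bool" where
  "has_locality n C r \<longleftrightarrow>
     (\<forall>i<n. \<exists>N. N \<subseteq> {..<n} - {i} \<and> card N \<le> r \<and>
        (\<forall>c\<in>C. \<forall>c'\<in>C. (\<forall>j\<in>N. c $ j = c' $ j) \<longrightarrow> c $ i = c' $ i))"

section \<open>Reed--Solomon codes\<close>

definition rs_encode :: "'a::field list \<Rightarrow> 'a poly \<Rightarrow> 'a list" where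
  "rs_encode \<alpha>s h = map (poly h) \<alpha>s"

text \<open>The zero polynomial has \<open>degree\<close> \<open>0\<close> in the library; mathematically its degree is below every \<open>k\<close>.\<close>

definition rs_code :: "'a::field list \<Rightarrow> nat \<Rightarrow> 'a list set" where
  "rs_code \<alpha>s k = rs_encode \<alpha>s ` {h. h = 0 \<or> degree h < k}"

section \<open>Generalized algebraic-geometric codes on the rational function field\<close>

text \<open>A finite place of the rational function field is given by its monic irreducible polynomial.\<close>

definition places_of_degree :: "nat \<Rightarrow> 'a::field poly set" where
  "places_of_degree d = {p. lead_coeff p = 1 \<and> irreducible p \<and> degree p = d}"

text \<open>The code \<open>C(P\<^sub>1, \<dots>, P\<^sub>s : m P\<^sub>\<infinity> : C\<^sub>1, \<dots>, C\<^sub>s)\<close> for finite places \<open>P\<^sub>i\<close>,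
  given by polynomials \<open>p\<^sub>i\<close>.
  The Riemann--Roch space of \<open>m P\<^sub>\<infinity>\<close> is the space of polynomials of degree at most \<open>m\<close>.  The residue
  class field at \<open>P\<^sub>i\<close> is identified with the remainders modulo \<open>p\<^sub>i\<close>, and the component code \<open>C\<^sub>i\<close> is
  given by its encoding map on these remainders, the \<open>i\<close>-th entry of \<open>\<pi>s\<close>.\<close>

definition gag_code :: "'a::field poly list \<Rightarrow> nat \<Rightarrow> ('a poly \<Rightarrow> 'a list) list \<Rightarrow> 'a vec set" where
  "gag_code ps m \<pi>s =
     {vec_of_list (concat (map2 (\<lambda>p \<pi>. \<pi> (f mod p)) ps \<pi>s)) | f. degree f \<le> m}"

text \<open>With \<open>rs_encode \<alpha>s\<close> as encoding map at a place, the component code is the Reed--Solomon code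
  whose dimension parameter is the degree of the place.\<close>

lemma rs_encode_residues:
  fixes p :: "'a::field poly"
  assumes "p \<noteq> 0"
  shows "range (\<lambda>f. rs_encode \<alpha>s (f mod p)) = rs_code \<alpha>s (degree p)"
proof -
  have "range (\<lambda>f. f mod p) = {h. h = 0 \<or> degree h < degree p}" (is "?L = ?R")
  proof
    show "?L \<subseteq> ?R"
      using degree_mod_less[OF assms] by auto
    show "?R \<subseteq> ?L"
    proof
      fix h assume "h \<in> ?R"
      then have "h = h mod p"
        by (auto simp: mod_poly_less)
      then show "h \<in> ?L" by blast
    qed
  qed
  then show ?thesis
    unfolding rs_code_def by (metis image_image)
qed

end

theory Submission
  imports Defs "HOL-Computational_Algebra.Polynomial_Factorial" "HOL-Library.Cardinality"
begin

text \<open>A nonzero \<open>f\<close> of degree at most \<open>2t - 2\<close> has a nonzero remainder at some place, and each nonzero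
  remainder contributes weight at least \<open>2\<close>.  The weight could therefore drop below \<open>3\<close> only if
  exactly one remainder, at \<open>p\<close> say, is nonzero.  Then \<open>f\<close> is a scalar multiple of the product of
  the other places, and the crucial point is that this product is a nonzero \<^emph>\<open>constant\<close> modulo \<open>p\<close>,
  so that \<open>f\<close> has weight exactly \<open>3\<close>.

  The monic quadratics other than \<open>p\<close> represent all nonzero residues modulo \<open>p\<close>, and their product is
  constant because the Frobenius map permutes the residues.  The split quadratics multiply to
  \<open>g ^ (q + 1)\<close> with \<open>g\<close> the product of all \<open>x - a\<close>; modulo \<open>p\<close> this is a norm, hence constant.
  The quotient of the two is the product of the other places.\<close>

section \<open>Divisibility by products of distinct monic irreducibles\<close>

lemma monic_irreducible_dvd_imp_eq:
  fixes p r :: "'a::field poly"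
  assumes "lead_coeff p = 1" "irreducible p" "lead_coeff r = 1" "irreducible r" "p dvd r"
  shows "p = r"
proof -
  from \<open>p dvd r\<close> obtain s where s: "r = p * s" by (auto simp: dvd_def)
  have "\<not> is_unit p" using assms by (auto simp: irreducible_def)
  with s assms(4) have "is_unit s" by (auto dest: irreducibleD)
  then obtain c where c: "s = [:c:]" by (auto elim: is_unit_polyE)
  have "c = 1" using s c assms by (auto simp: lead_coeff_mult)
  with s c show ?thesis by simp
qed

lemma prime_elem_dvd_prod:
  assumes "prime_elem p" "finite A" "p dvd (\<Prod>x\<in>A. f x)"
  shows "\<exists>x\<in>A. p dvd f x"
  using assms(2,3)
proof (induction A rule: finite_induct)
  case empty
  with assms(1) show ?case by (simp add: prime_elem_def)
next
  case (insert x A)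
  then have "p dvd f x \<or> p dvd (\<Prod>x\<in>A. f x)"
    using prime_elem_dvd_multD[OF assms(1)] by simp
  with insert.IH show ?case by blast
qed

text \<open>Induction on the set: the new factor \<open>p\<close> is prime and does not divide the
  product split off so far, since it would then divide, hence equal, one of its factors. So it
  divides the cofactor.\<close>

lemma prod_monic_irreducible_dvd:
  fixes f :: "'a::field poly"
  assumes "finite A" "\<And>p. p \<in> A \<Longrightarrow> lead_coeff p = 1 \<and> irreducible p \<and> p dvd f"
  shows "\<Prod>A dvd f"
  using assms
proof (induction A rule: finite_induct)
  case (insert p A)
  have p: "lead_coeff p = 1" "irreducible p" "p dvd f" using insert by auto
  have prime: "prime_elem p" using p by (intro field_poly_irreducible_imp_prime)
  obtain h where h: "f = \<Prod>A * h" using insert by (auto simp: dvd_def)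
  have "\<not> p dvd \<Prod>A"
  proof
    assume "p dvd \<Prod>A"
    then obtain r where "r \<in> A" "p dvd r"
      using prime_elem_dvd_prod[OF prime \<open>finite A\<close>] by blast
    with insert p show False using monic_irreducible_dvd_imp_eq[of p r] by auto
  qed
  with h p(3) prime have "p dvd h" using prime_elem_dvd_mult_iff by metis
  then show ?case using h insert by (auto simp: mult.commute mult_dvd_mono)
qed simp

section \<open>Congruences modulo \<open>p\<close>, written as \<open>p dvd a - b\<close>\<close>

lemma dvd_mult_diff:
  fixes p a b c d :: "'a::comm_ring_1"
  assumes "p dvd a - b" "p dvd c - d"
  shows "p dvd a * c - b * d"
proof -
  have "a * c - b * d = (a - b) * c + b * (c - d)" by (simp add: algebra_simps)
  with assms show ?thesis by (metis dvd_add dvd_mult dvd_mult2)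
qed

lemma dvd_prod_diff:
  fixes p :: "'a::comm_ring_1"
  assumes "\<And>x. x \<in> A \<Longrightarrow> p dvd f x - g x"
  shows "p dvd (\<Prod>x\<in>A. f x) - (\<Prod>x\<in>A. g x)"
  using assms by (induction A rule: infinite_finite_induct) (auto intro: dvd_mult_diff)

lemma dvd_power_diff:
  fixes p :: "'a::comm_ring_1"
  assumes "p dvd a - b"
  shows "p dvd a ^ n - b ^ n"
  using dvd_prod_diff[of "{..<n}" p "\<lambda>_. a" "\<lambda>_. b"] assms by simp

lemma dvd_diff_trans:
  fixes p :: "'a::comm_ring_1"
  assumes "p dvd a - b" "p dvd b - c"
  shows "p dvd a - c"
  using dvd_add[OF assms] by simp

lemma dvd_diff_sym:
  fixes p :: "'a::comm_ring_1"
  assumes "p dvd a - b"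
  shows "p dvd b - a"
  using assms by (metis dvd_minus_iff minus_diff_eq)

section \<open>Monic quadratic polynomials over a finite field\<close>

lemma irreducible_linear: "irreducible [:- a, 1 :: 'a::field:]"
proof (rule irreducibleI)
  fix r s :: "'a poly" assume rs: "[:- a, 1:] = r * s"
  then have "r \<noteq> 0" "s \<noteq> 0" by auto
  moreover from this have "degree r + degree s = 1"
    using arg_cong[OF rs, of degree] degree_mult_eq[of r s] by simp
  ultimately show "is_unit r \<or> is_unit s" by (auto simp: is_unit_iff_degree add_is_1)
qed (auto simp: is_unit_pCons_iff)

definition monic_quadratics :: "'a::field poly set" where
  "monic_quadratics = {p. lead_coeff p = 1 \<and> degree p = 2}"

text \<open>Indexing by a double root or by the set of two distinct roots lists every split
  quadratic exactly once, so that both the count and the product follow by reindexing. The pairs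
  \<open>(a, b)\<close> of \<open>split_quadratics_eq\<close> would list most of them twice.\<close>

definition split_quadratics :: "'a::field poly set" where
  "split_quadratics = (\<lambda>a. [:-a, 1:] ^ 2) ` UNIV \<union> (\<lambda>S. \<Prod>a\<in>S. [:-a, 1:]) ` {S. card S = 2}"

lemma monic_quadratics_eq: "monic_quadratics = (\<lambda>(a, b). [:a, b, 1 :: 'a::field:]) ` UNIV"
proof (intro equalityI subsetI)
  fix p :: "'a poly" assume "p \<in> monic_quadratics"
  then have p: "lead_coeff p = 1" "degree p = 2" by (auto simp: monic_quadratics_def)
  then obtain a b where "p = [:a, b, 1:]"
    by (metis degree2_coeffs coeff_pCons_Suc coeff_pCons_0 numeral_2_eq_2)
  then show "p \<in> (\<lambda>(a, b). [:a, b, 1:]) ` UNIV" by auto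
qed (auto simp: monic_quadratics_def)

lemma card_monic_quadratics:
  "card (monic_quadratics :: 'a::{field,finite} poly set) = CARD('a)^2"
proof -
  have "inj (\<lambda>(a, b). [:a, b, 1 :: 'a:])" by (auto simp: inj_def)
  then show ?thesis unfolding monic_quadratics_eq
    by (simp add: card_image power2_eq_square)
qed

lemma finite_monic_quadratics: "finite (monic_quadratics :: 'a::{field,finite} poly set)"
  unfolding monic_quadratics_eq by simp

lemma prod_linear_root_iff:
  assumes "finite S"
  shows "poly (\<Prod>a\<in>S. [:-a, 1 :: 'a::field:]) x = 0 \<longleftrightarrow> x \<in> S"
  using assms by (auto simp: poly_prod prod_zero_iff)

lemma degree_prod_linear: "finite S \<Longrightarrow> degree (\<Prod>a\<in>S. [:-a, 1 :: 'a::field:]) = card S"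
  by (subst degree_prod_eq_sum_degree) auto

lemma split_quadratics_eq: "split_quadratics = {[:-a, 1:] * [:-b, 1 :: 'a::field:] | a b. True}"
  (is "?L = ?R")
proof (intro equalityI subsetI)
  fix p assume "p \<in> ?L"
  then consider a where "p = [:-a, 1:] ^ 2" | S where "card S = 2" "p = (\<Prod>a\<in>S. [:-a, 1:])"
    by (auto simp: split_quadratics_def)
  then show "p \<in> ?R"
  proof cases
    case 2
    then obtain a b where "S = {a, b}" "a \<noteq> b" by (auto simp: card_2_iff)
    with 2 show ?thesis by auto
  next
    case 1
    then show ?thesis unfolding power2_eq_square by blast
  qed
next
  fix p :: "'a poly" assume "p \<in> ?R"
  then obtain a b where p: "p = [:-a, 1:] * [:-b, 1:]" by auto
  show "p \<in> ?L"
  proof (cases "a = b")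
    case False
    then have "p = (\<Prod>c\<in>{a, b}. [:-c, 1:])" "card {a, b} = 2" using p by auto
    then show ?thesis unfolding split_quadratics_def by blast
  qed (auto simp: p split_quadratics_def power2_eq_square)
qed

lemma monic_quadratics_partition:
  shows "monic_quadratics = places_of_degree 2 \<union> (split_quadratics :: 'a::field poly set)"
    and "places_of_degree 2 \<inter> (split_quadratics :: 'a::field poly set) = {}"
proof -
  have red: "\<not> irreducible ([:-a, 1:] * [:-b, 1 :: 'a:])" for a b
    using irreducibleD[OF _ refl, of "[:-a, 1:]" "[:-b, 1:]"] by (auto simp: is_unit_pCons_iff simp del: mult_pCons_left mult_pCons_right)
  show "places_of_degree 2 \<inter> (split_quadratics :: 'a poly set) = {}"
    using red unfolding split_quadratics_eq places_of_degree_def by blast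
  have "p \<in> split_quadratics" if "lead_coeff p = 1" "degree p = 2" "\<not> irreducible p" for p :: "'a poly"
  proof -
    note p12 = that(1,2) and p3 = that(3)
    have "p \<noteq> 0" using that by auto
    moreover have "\<not> is_unit p" using that(2) by (auto elim!: is_unit_polyE)
    ultimately obtain r s where rs: "p = r * s" "\<not> is_unit r" "\<not> is_unit s"
      using p3 by (auto simp: irreducible_def)
    have "degree u \<noteq> 0" if "\<not> is_unit u" "u \<noteq> 0" for u :: "'a poly"
      using that by (simp add: is_unit_iff_degree)
    moreover have "r \<noteq> 0" "s \<noteq> 0" "degree r + degree s = 2"
      using rs(1) \<open>p \<noteq> 0\<close> p12 degree_mult_eq[of r s] by auto
    ultimately have "degree r \<noteq> 0" "degree s \<noteq> 0" "degree r + degree s = 2"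
      using rs(2,3) by auto
    then have "degree r = 1" "degree s = 1" by linarith+
    then obtain a b c d where ab: "r = [:a, b:]" "s = [:c, d:]"
      by (metis degree1_coeffs)
    then have "lead_coeff r = b" "lead_coeff s = d"
      using \<open>degree r = 1\<close> \<open>degree s = 1\<close> by auto
    then have bd: "b * d = 1" using p12(1) rs(1) lead_coeff_mult[of r s] by simp
    \<comment> \<open>Multiplying \<open>r\<close> by \<open>d\<close> and \<open>s\<close> by
      \<open>b\<close> makes both monic and, as \<open>b * d = 1\<close>, leaves the product
      unchanged; the roots are then \<open>- a * d\<close> and \<open>- b * c\<close>.\<close>
    have "p = [:-(- a * d), 1:] * [:-(- b * c), 1:]"
      using bd unfolding rs(1) ab by (auto simp: field_simps nonzero_eq_divide_eq)
    then show ?thesis unfolding split_quadratics_eq by blast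
  qed
  moreover have "split_quadratics \<subseteq> (monic_quadratics :: 'a poly set)"
    unfolding split_quadratics_eq monic_quadratics_def by auto
  ultimately show "monic_quadratics = places_of_degree 2 \<union> (split_quadratics :: 'a poly set)"
    unfolding monic_quadratics_def places_of_degree_def by blast
qed

section \<open>Counting and multiplying the split quadratics\<close>

lemma inj_linear_square: "inj (\<lambda>a. [:-a, 1 :: 'a::field:] ^ 2)"
proof (rule injI)
  fix a b :: 'a assume "[:-a, 1:] ^ 2 = [:-b, 1:] ^ 2"
  then have "poly ([:-a, 1:] ^ 2) b = poly ([:-b, 1:] ^ 2) b" by (rule arg_cong)
  then show "a = b" unfolding poly_power by simp
qed

lemma inj_on_prod_linear: "inj_on (\<lambda>S. \<Prod>a\<in>S. [:-a, 1 :: 'a::field:]) {S. finite S}"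
proof (rule inj_onI)
  fix S T :: "'a set"
  assume "S \<in> {S. finite S}" "T \<in> {S. finite S}"
    and eq: "(\<Prod>a\<in>S. [:-a, 1:]) = (\<Prod>a\<in>T. [:-a, 1:])"
  then have fin: "finite S" "finite T" by auto
  show "S = T"
    using prod_linear_root_iff[OF fin(1)] prod_linear_root_iff[OF fin(2)] unfolding eq by blast
qed

lemma inj_on_prod_linear_pair: "inj_on (\<lambda>S. \<Prod>a\<in>S. [:-a, 1 :: 'a::field:]) {S. card S = 2}"
  by (rule inj_on_subset[OF inj_on_prod_linear]) (auto intro: card_ge_0_finite)

lemma split_quadratics_disjoint:
  "range (\<lambda>a. [:-a, 1 :: 'a::field:] ^ 2) \<inter> (\<lambda>S. \<Prod>a\<in>S. [:-a, 1:]) ` {S. card S = 2} = {}"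
proof -
  have "card S \<noteq> 2" if "[:-a, 1:] ^ 2 = (\<Prod>a\<in>S. [:-a, 1 :: 'a:])" for a S
  proof
    assume S: "card S = 2"
    then have "finite S" by (auto intro: card_ge_0_finite)
    have "x \<in> S \<longleftrightarrow> x = a" for x
      using prod_linear_root_iff[OF \<open>finite S\<close>, of x] that[symmetric] by simp
    then have "S = {a}" by auto
    with S show False by simp
  qed
  then show ?thesis by auto
qed

lemma card_split_quadratics:
  "card (split_quadratics :: 'a::{field,finite} poly set) = CARD('a) + (CARD('a) choose 2)"
  unfolding split_quadratics_def
  using n_subsets[of "UNIV :: 'a set" 2] split_quadratics_disjoint
    card_image[OF inj_linear_square[where 'a='a]] card_image[OF inj_on_prod_linear_pair[where 'a='a]]
  by (subst card_Un_disjoint) auto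

text \<open>By complement: removing the q double-root quadratics and the \<open>q choose 2\<close>
  with distinct roots from all q^2 monic quadratics leaves \<open>q choose 2\<close>.\<close>

lemma card_places_of_degree_2:
  "card (places_of_degree 2 :: 'a::{field,finite} poly set) = (CARD('a)^2 - CARD('a)) div 2"
proof -
  let ?P = "places_of_degree 2 :: 'a poly set" and ?q = "CARD('a)"
  have "finite ?P" "finite (split_quadratics :: 'a poly set)"
    using finite_monic_quadratics monic_quadratics_partition(1) by (metis finite_Un)+
  then have "?q^2 = card ?P + (?q + (?q choose 2))"
    using card_monic_quadratics[where 'a='a] monic_quadratics_partition(2)[where 'a='a]
      card_split_quadratics[where 'a='a]
    unfolding monic_quadratics_partition(1) by (metis card_Un_disjoint)
  moreover have "?q^2 = ?q + 2 * (?q choose 2)"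
  proof -
    have "2 * (?q choose 2) = ?q * (?q - 1)"
      unfolding choose_two by (rule dvd_mult_div_cancel) simp
    then show ?thesis by (simp add: power2_eq_square algebra_simps)
  qed
  ultimately have "card ?P = ?q choose 2" "?q^2 - ?q = 2 * (?q choose 2)" by linarith+
  then show ?thesis by simp
qed

lemma card_pairs_containing: "card {S. card S = 2 \<and> (a :: 'a) \<in> S} = CARD('a::finite) - 1"
proof -
  have "{S. card S = 2 \<and> a \<in> S} = (\<lambda>b. {a, b}) ` (UNIV - {a})"
    by (auto simp: card_2_iff)
  moreover have "inj_on (\<lambda>b. {a, b}) (UNIV - {a})" by (auto simp: inj_on_def doubleton_eq_iff)
  ultimately show ?thesis by (simp add: card_image card_Diff_singleton)
qed

text \<open>Each factor x - a occurs twice in its own square and once for each of the q - 1 pairs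
  containing a, hence q + 1 times. The pairs are handled by exchanging the product over sets S with
  the product over their elements.\<close>

lemma prod_split_quadratics:
  "\<Prod>(split_quadratics :: 'a::{field,finite} poly set) = (\<Prod>a\<in>UNIV. [:-a, 1:]) ^ (CARD('a) + 1)"
proof -
  let ?l = "\<lambda>a. [:-a, 1 :: 'a:]"
  have "(\<Prod>S | card S = 2. prod ?l S) = (\<Prod>S\<in>{S. card S = 2}. \<Prod>a\<in>{a \<in> UNIV. a \<in> S}. ?l a)"
    by simp
  also have "\<dots> = (\<Prod>a\<in>UNIV. \<Prod>S\<in>{S \<in> {S. card S = 2}. a \<in> S}. ?l a)"
    by (rule prod.swap_restrict) auto
  also have "\<dots> = (\<Prod>a\<in>UNIV. ?l a) ^ (CARD('a) - 1)"
    by (simp add: card_pairs_containing prod_power_distrib)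
  finally have pairs: "(\<Prod>S | card S = 2. prod ?l S) = (\<Prod>a\<in>UNIV. ?l a) ^ (CARD('a) - 1)" .
  have "\<Prod>split_quadratics = \<Prod>(range (\<lambda>a. ?l a ^ 2)) * \<Prod>(prod ?l ` {S. card S = 2})"
    unfolding split_quadratics_def using split_quadratics_disjoint[where 'a='a]
    by (intro prod.union_disjoint) auto
  also have "\<dots> = (\<Prod>a\<in>UNIV. ?l a ^ 2) * (\<Prod>S | card S = 2. prod ?l S)"
    using prod.reindex[OF inj_linear_square[where 'a='a], of "\<lambda>x. x"]
      prod.reindex[OF inj_on_prod_linear_pair[where 'a='a], of "\<lambda>x. x"]
    by (simp add: o_def)
  also have "\<dots> = (\<Prod>a\<in>UNIV. ?l a) ^ (2 + (CARD('a) - 1))"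
    unfolding pairs power_add by (simp add: prod_power_distrib)
  also have "2 + (CARD('a) - 1) = CARD('a) + 1"
    using finite_UNIV_card_ge_0[where 'a='a] by simp
  finally show ?thesis .
qed

section \<open>Residues modulo an irreducible quadratic\<close>

text \<open>These are the canonical representatives of the nonzero residue classes modulo any
  quadratic, that is, of the multiplicative group of the residue field.\<close>

definition nonzero_linear :: "'a::zero poly set" where
  "nonzero_linear = {r. r \<noteq> 0 \<and> degree r < 2}"

lemma nonzero_linear_eq: "nonzero_linear = (\<lambda>(a, b). [:a, b:]) ` UNIV - {0}"
proof (intro equalityI subsetI)
  fix r :: "'a poly" assume r: "r \<in> nonzero_linear"
  then have "r = [:coeff r 0, coeff r 1:]"
    by (intro poly_eqI) (auto simp: nonzero_linear_def coeff_pCons coeff_eq_0 split: nat.splits)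
  then obtain a b where "r = [:a, b:]" by blast
  with r show "r \<in> (\<lambda>(a, b). [:a, b:]) ` UNIV - {0}"
    by (auto simp: nonzero_linear_def)
qed (auto simp: nonzero_linear_def)

lemma finite_nonzero_linear: "finite (nonzero_linear :: 'a::{zero,finite} poly set)"
  unfolding nonzero_linear_eq by simp

lemma card_nonzero_linear: "card (nonzero_linear :: 'a::{zero,finite} poly set) = CARD('a)^2 - 1"
proof -
  have inj: "inj (\<lambda>(a, b). [:a, b :: 'a:])" by (auto simp: inj_def)
  have "0 \<in> range (\<lambda>(a, b). [:a, b :: 'a:])"
    by (rule image_eqI[of _ _ "(0, 0)"]) auto
  then show ?thesis
    unfolding nonzero_linear_eq using card_image[OF inj] by (simp add: card_Diff_singleton power2_eq_square)
qed

text \<open>The library has \<open>finite_field_power_card_eq_same\<close> only for the class \<open>finite_field\<close>,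
  which the sort \<open>{field, finite}\<close> does not entail.\<close>

lemma power_card_eq_same: "a ^ CARD('a) = (a :: 'a::{field,finite})"
proof (cases "a = 0")
  case False
  \<comment> \<open>Multiplication by \<open>a\<close> permutes the nonzero elements; comparing
    their product before and after forces \<open>a ^ (CARD('a) - 1) = 1\<close>.\<close>
  let ?P = "\<Prod>(UNIV - {0 :: 'a})"
  have "bij_betw ((*) a) (UNIV - {0}) (UNIV - {0})"
    using False by (intro bij_betwI[of _ _ _ "\<lambda>y. y / a"]) auto
  then have "?P = (\<Prod>y\<in>UNIV - {0}. a * y)"
    using prod.reindex_bij_betw[of "(*) a" "UNIV - {0}" "UNIV - {0}" "\<lambda>y. y"] by simp
  also have "\<dots> = a ^ (CARD('a) - 1) * ?P"
    by (simp add: prod.distrib card_Diff_singleton)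
  finally have "a ^ (CARD('a) - 1) = 1" by simp
  then show ?thesis by (simp add: power_eq_if)
qed (simp add: zero_power)

text \<open>x^q - x vanishes at all q field elements, so every x - a divides it, and its degree
  leaves room only for a constant cofactor. Substituting a polynomial for x later identifies the
  residues fixed by Frobenius.\<close>

lemma power_card_minus_self:
  "\<exists>c. monom 1 CARD('a::{field,finite}) - monom 1 1 = [:c:] * (\<Prod>a\<in>UNIV. [:-a, 1 :: 'a:])"
proof -
  let ?f = "monom 1 CARD('a) - monom 1 1 :: 'a poly"
  have q: "CARD('a) > 1"
    using card_mono[of "UNIV :: 'a set" "{0, 1}"] by simp
  have "coeff ?f CARD('a) = 1" using q by simp
  then have "?f \<noteq> 0" by (auto simp only: coeff_0 zero_neq_one)
  have "degree ?f \<le> CARD('a)" using q by (intro degree_diff_le) (auto simp: degree_monom_le degree_monom_eq)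
  have "[:-a, 1:] dvd ?f" for a
    by (simp add: poly_eq_0_iff_dvd[symmetric] poly_monom power_card_eq_same)
  then have "\<Prod>(range (\<lambda>a. [:-a, 1:])) dvd ?f"
    by (intro prod_monic_irreducible_dvd) (auto simp: irreducible_linear)
  also have "\<Prod>(range (\<lambda>a. [:-a, 1:])) = (\<Prod>a\<in>UNIV. [:-a, 1 :: 'a:])"
    by (subst prod.reindex) (auto simp: inj_def)
  finally obtain h where h: "?f = (\<Prod>a\<in>UNIV. [:-a, 1:]) * h" by (auto simp: dvd_def)
  then have "h \<noteq> 0" "(\<Prod>a\<in>UNIV. [:-a, 1 :: 'a:]) \<noteq> 0" using \<open>?f \<noteq> 0\<close> by auto
  then have "degree ?f = CARD('a) + degree h"
    using degree_mult_eq[of "\<Prod>a\<in>UNIV. [:-a, 1 :: 'a:]" h] degree_prod_linear[of "UNIV :: 'a set"]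
    unfolding h by simp
  with \<open>degree ?f \<le> _\<close> have "degree h = 0" by simp
  then obtain c where "h = [:c:]" by (rule degree_eq_zeroE)
  then show ?thesis using h by auto
qed

section \<open>Arithmetic of the residue field modulo a fixed irreducible quadratic
  \<open>p\<close>\<close>

context
  fixes p :: "'a::{field,finite} poly"
  assumes irr: "irreducible p" and deg: "degree p = 2"
begin

private lemma prime: "prime_elem p"
  using irr by (rule field_poly_irreducible_imp_prime)

private lemma not_dvd_const: "c \<noteq> 0 \<Longrightarrow> \<not> p dvd [:c:]"
  using dvd_imp_degree_le[of p "[:c:]"] deg by auto

private lemma not_dvd_linear: "r \<in> nonzero_linear \<Longrightarrow> \<not> p dvd r"
  using dvd_imp_degree_le[of p r] deg by (auto simp: nonzero_linear_def)

private lemma linear_eqI: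
  assumes "r \<in> nonzero_linear" "s \<in> nonzero_linear" "p dvd r - s"
  shows "r = s"
proof (rule ccontr)
  assume "r \<noteq> s"
  moreover have "degree (r - s) < 2"
    using assms(1,2) by (intro degree_diff_less) (auto simp: nonzero_linear_def)
  ultimately have "r - s \<in> nonzero_linear" by (simp add: nonzero_linear_def)
  then show False using assms(3) not_dvd_linear by blast
qed

private lemma not_dvd_prod_linear: "\<not> p dvd \<Prod>nonzero_linear"
proof
  assume "p dvd \<Prod>nonzero_linear"
  then obtain r where "r \<in> nonzero_linear" "p dvd r"
    using prime_elem_dvd_prod[OF prime finite_nonzero_linear] by blast
  then show False using not_dvd_linear by blast
qed

text \<open>An injective self-map of a finite set is a permutation, so it preserves the product of
  all nonzero residues. The values \<open>h y\<close> may have large degree; it is their remainders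
  that are permuted. Applied below to multiplication by a unit and to Frobenius.\<close>

private lemma prod_permuted_residues:
  assumes nz: "\<And>y. y \<in> nonzero_linear \<Longrightarrow> \<not> p dvd h y"
    and inj: "\<And>y z. y \<in> nonzero_linear \<Longrightarrow> z \<in> nonzero_linear \<Longrightarrow> p dvd h y - h z \<Longrightarrow> p dvd y - z"
  shows "p dvd (\<Prod>y\<in>nonzero_linear. h y) - \<Prod>nonzero_linear"
proof -
  have p0: "p \<noteq> 0" using deg by auto
  have maps: "h y mod p \<in> nonzero_linear" if "y \<in> nonzero_linear" for y
    using nz[OF that] degree_mod_less[OF p0, of "h y"]
    unfolding nonzero_linear_def deg mod_eq_0_iff_dvd by blast
  have inj': "inj_on (\<lambda>y. h y mod p) nonzero_linear"
  proof (rule inj_onI)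
    fix y z assume yz: "y \<in> nonzero_linear" "z \<in> nonzero_linear" "h y mod p = h z mod p"
    then have "(h y - h z) mod p = 0" by (simp only: poly_mod_diff_left diff_self)
    then have "p dvd h y - h z" by (simp only: mod_eq_0_iff_dvd)
    with yz show "y = z" using linear_eqI[OF _ _ inj[of y z]] by blast
  qed
  then have "(\<lambda>y. h y mod p) ` nonzero_linear = nonzero_linear"
    using maps finite_nonzero_linear by (intro endo_inj_surj) auto
  then have "\<Prod>nonzero_linear = (\<Prod>y\<in>nonzero_linear. h y mod p)"
    using prod.reindex[OF inj', of "\<lambda>x. x"] by simp
  moreover have "p dvd (\<Prod>y\<in>nonzero_linear. h y) - (\<Prod>y\<in>nonzero_linear. h y mod p)"
    by (rule dvd_prod_diff) (rule dvd_minus_mod)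
  ultimately show ?thesis by (simp only:)
qed

text \<open>The residue field has q^2 - 1 nonzero elements. Multiplication by \<open>y\<close>
  permutes them, so their product, which \<open>p\<close> does not divide, can be cancelled.\<close>

private lemma fermat:
  assumes "\<not> p dvd y"
  shows "p dvd y ^ (CARD('a)^2 - 1) - 1"
proof -
  have "p dvd (\<Prod>r\<in>nonzero_linear. y * r) - \<Prod>nonzero_linear"
    using assms not_dvd_linear
    by (intro prod_permuted_residues)
      (auto simp: prime_elem_dvd_mult_iff[OF prime] right_diff_distrib[symmetric])
  also have "(\<Prod>r\<in>nonzero_linear. y * r) = y ^ (CARD('a)^2 - 1) * \<Prod>nonzero_linear"
    by (simp add: prod.distrib card_nonzero_linear)
  also have "\<dots> - \<Prod>nonzero_linear = (y ^ (CARD('a)^2 - 1) - 1) * \<Prod>nonzero_linear"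
    by (simp add: left_diff_distrib)
  finally show ?thesis
    using not_dvd_prod_linear by (simp add: prime_elem_dvd_mult_iff[OF prime])
qed

private lemma power_card_square:
  "p dvd y ^ (CARD('a)^2) - y"
proof (cases "p dvd y")
  case True
  then have "p dvd y ^ (CARD('a)^2)"
    by (rule dvd_trans) (simp add: dvd_power)
  then show ?thesis using True by (rule dvd_diff)
next
  case False
  have "y ^ (CARD('a)^2 - 1) * y = y ^ (CARD('a)^2)" by (rule power_minus_mult) simp
  then have "y ^ (CARD('a)^2) - y = (y ^ (CARD('a)^2 - 1) - 1) * y"
    by (simp only: left_diff_distrib mult_1)
  then show ?thesis using fermat[OF False] by simp
qed

text \<open>Substituting \<open>z\<close> into the factorization of x^q - x shows that
  \<open>p\<close> divides the product of all z - a; being prime, it divides one factor. So the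
  fixed residues are exactly those of the base field.\<close>

private lemma frobenius_fixed_imp_const:
  assumes "p dvd z ^ CARD('a) - z"
  shows "\<exists>c. p dvd z - [:c:]"
proof -
  obtain c where c: "monom 1 CARD('a) - monom 1 1 = [:c:] * (\<Prod>a\<in>UNIV. [:-a, 1 :: 'a:])"
    using power_card_minus_self by blast
  have "c \<noteq> 0"
  proof
    assume "c = 0"
    then have "monom 1 CARD('a) = (monom 1 1 :: 'a poly)" using c by simp
    then have "CARD('a) = 1" by (metis degree_monom_eq zero_neq_one)
    then show False using card_mono[of "UNIV :: 'a set" "{0, 1}"] by simp
  qed
  have "pcompose (monom 1 n) z = z ^ n" for n
    by (induction n) (simp_all add: monom_Suc pcompose_pCons monom_0 one_pCons)
  then have "z ^ CARD('a) - z = pcompose (monom 1 CARD('a) - monom 1 1) z"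
    by (simp add: pcompose_diff)
  also have "\<dots> = [:c:] * (\<Prod>a\<in>UNIV. z - [:a:])"
    unfolding c pcompose_mult pcompose_prod
    by (intro arg_cong2[where f = "(*)"] prod.cong) (simp_all add: pcompose_pCons)
  finally have "p dvd (\<Prod>a\<in>UNIV. z - [:a:])"
    using assms not_dvd_const[OF \<open>c \<noteq> 0\<close>] by (simp add: prime_elem_dvd_mult_iff[OF prime] del: mult_pCons_left)
  then show ?thesis
    using prime_elem_dvd_prod[OF prime finite] by blast
qed

text \<open>Frobenius sends y^(q+1) to y^(q^2) y^q, which is congruent to y y^q, that is, to y^(q+1)
  again. This is the norm from the residue field to the base field.\<close>

private lemma norm_const: "\<exists>c. p dvd y ^ (CARD('a) + 1) - [:c:]"
proof -
  have "(y ^ (CARD('a) + 1)) ^ CARD('a) = y ^ ((CARD('a) + 1) * CARD('a))"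
    by (rule power_mult[symmetric])
  also have "(CARD('a) + 1) * CARD('a) = CARD('a)^2 + CARD('a)"
    by (simp add: power2_eq_square)
  also have "y ^ (CARD('a)^2 + CARD('a)) = y ^ (CARD('a)^2) * y ^ CARD('a)"
    by (rule power_add)
  finally have "(y ^ (CARD('a) + 1)) ^ CARD('a) = y ^ (CARD('a)^2) * y ^ CARD('a)" .
  then have "(y ^ (CARD('a) + 1)) ^ CARD('a) - y ^ (CARD('a) + 1)
      = y ^ (CARD('a)^2) * y ^ CARD('a) - y * y ^ CARD('a)"
    by (rule arg_cong2[where f = "(-)"]) simp
  moreover have "p dvd y ^ (CARD('a)^2) * y ^ CARD('a) - y * y ^ CARD('a)"
    by (rule dvd_mult_diff[OF power_card_square]) simp
  ultimately have "p dvd (y ^ (CARD('a) + 1)) ^ CARD('a) - y ^ (CARD('a) + 1)"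
    by (rule ssubst)
  then show ?thesis
    by (rule frobenius_fixed_imp_const)
qed

text \<open>Frobenius permutes the nonzero residues, hence fixes their product.\<close>

private lemma prod_residues_const: "\<exists>c. p dvd \<Prod>nonzero_linear - [:c:]"
proof (rule frobenius_fixed_imp_const)
  have "p dvd (\<Prod>y\<in>nonzero_linear. y ^ CARD('a)) - \<Prod>nonzero_linear"
  proof (rule prod_permuted_residues)
    fix y :: "'a poly" assume "y \<in> nonzero_linear"
    then show "\<not> p dvd y ^ CARD('a)" using not_dvd_linear prime_elem_dvd_power[OF prime, of y] by blast
  next
    fix y z :: "'a poly" assume "p dvd y ^ CARD('a) - z ^ CARD('a)"
    \<comment> \<open>Injectivity of Frobenius: a second application gives the q^2-th powers, which
      are congruent to \<open>y\<close> and \<open>z\<close> themselves.\<close>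
    then have "p dvd (y ^ CARD('a)) ^ CARD('a) - (z ^ CARD('a)) ^ CARD('a)" by (rule dvd_power_diff)
    then have "p dvd y ^ (CARD('a)^2) - z ^ (CARD('a)^2)"
      by (simp add: power_mult[symmetric] power2_eq_square)
    then have "p dvd y - z ^ (CARD('a)^2)"
      by (rule dvd_diff_trans[OF dvd_diff_sym[OF power_card_square]])
    then show "p dvd y - z"
      by (rule dvd_diff_trans[OF _ power_card_square])
  qed
  then show "p dvd \<Prod>nonzero_linear ^ CARD('a) - \<Prod>nonzero_linear"
    by (simp add: prod_power_distrib)
qed

lemma prod_other_places_const:
  assumes "lead_coeff p = 1"
  obtains c where "c \<noteq> 0" "\<Prod>(places_of_degree 2 - {p}) mod p = [:c:]"
proof -
  let ?F = "\<Prod>(places_of_degree 2 - {p})" and ?G = "\<Prod>(split_quadratics :: 'a poly set)"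
  have place: "p \<in> places_of_degree 2" using assms irr deg by (auto simp: places_of_degree_def)
  have "inj_on (\<lambda>r. p + r) nonzero_linear" by (auto simp: inj_on_def)
  \<comment> \<open>A monic quadratic other than \<open>p\<close> is \<open>p\<close> plus a nonzero
    remainder, so these quadratics represent each nonzero residue once.\<close>
  moreover have "(\<lambda>r. p + r) ` nonzero_linear = monic_quadratics - {p}"
  proof (intro equalityI subsetI)
    fix m assume "m \<in> (\<lambda>r. p + r) ` nonzero_linear"
    then obtain r where r: "m = p + r" "r \<in> nonzero_linear" by auto
    then have "degree m = 2" using deg degree_add_eq_left[of r p] by (auto simp: nonzero_linear_def)
    moreover have "coeff m 2 = 1" using r assms deg by (auto simp: nonzero_linear_def coeff_eq_0)
    ultimately show "m \<in> monic_quadratics - {p}"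
      using r by (auto simp: monic_quadratics_def nonzero_linear_def)
  next
    fix m assume m: "m \<in> monic_quadratics - {p}"
    then obtain a b where "m = [:a, b, 1:]" by (auto simp: monic_quadratics_eq)
    moreover have "p \<in> monic_quadratics" using place monic_quadratics_partition(1)[where 'a='a] by blast
    then obtain a' b' where "p = [:a', b', 1:]" by (auto simp: monic_quadratics_eq)
    ultimately have "degree (m - p) < 2" by auto
    then have "m - p \<in> nonzero_linear" using m by (auto simp: nonzero_linear_def)
    then show "m \<in> (\<lambda>r. p + r) ` nonzero_linear" by (intro image_eqI[of _ _ "m - p"]) auto
  qed
  ultimately have "\<Prod>(monic_quadratics - {p}) = (\<Prod>r\<in>nonzero_linear. p + r)"
    using prod.reindex[of "\<lambda>r. p + r" nonzero_linear "\<lambda>m. m"] by simp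
  moreover have "p dvd (\<Prod>r\<in>nonzero_linear. p + r) - (\<Prod>r\<in>nonzero_linear. r)"
    by (rule dvd_prod_diff) simp
  moreover have "\<Prod>(monic_quadratics - {p}) = ?F * ?G"
  proof -
    have "monic_quadratics - {p} = (places_of_degree 2 - {p}) \<union> split_quadratics"
      using place monic_quadratics_partition[where 'a='a] by blast
    moreover have "finite (places_of_degree 2 :: 'a poly set)" "finite (split_quadratics :: 'a poly set)"
      using finite_monic_quadratics monic_quadratics_partition(1) by (metis finite_Un)+
    moreover have "(places_of_degree 2 - {p}) \<inter> split_quadratics = {}"
      using monic_quadratics_partition(2)[where 'a='a] by blast
    ultimately show ?thesis by (simp only: prod.union_disjoint finite_Diff)
  qed
  ultimately have FG: "p dvd ?F * ?G - \<Prod>nonzero_linear" by simp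
  obtain w where w: "p dvd \<Prod>nonzero_linear - [:w:]" using prod_residues_const by blast
  with FG have w': "p dvd ?F * ?G - [:w:]" by (rule dvd_diff_trans)
  \<comment> \<open>The product of all x - a, raised to the power q + 1, is a norm.\<close>
  obtain d where d: "p dvd ?G - [:d:]" using norm_const unfolding prod_split_quadratics by blast
  \<comment> \<open>Products of nonzero residues are nonzero modulo \<open>p\<close>; this makes
    both constants \<open>d\<close> and \<open>w\<close> invertible, so that the quotient
    \<open>w / d\<close> is meaningful and nonzero.\<close>
  have notFG: "\<not> p dvd ?F * ?G"
  proof
    assume "p dvd ?F * ?G"
    from dvd_diff[OF this FG] show False using not_dvd_prod_linear by simp
  qed
  have "d \<noteq> 0" using notFG d by auto
  have "w \<noteq> 0" using notFG w' by auto
  have "p dvd ?F * ?G - ?F * [:d:]" using dvd_mult[OF d] by (simp only: right_diff_distrib)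
  from dvd_diff_trans[OF dvd_diff_sym[OF this] w'] have "p dvd ?F * [:d:] - [:w:]" .
  moreover have "?F * [:d:] - [:w:] = [:d:] * (?F - [:w / d:])"
    using \<open>d \<noteq> 0\<close> by (simp add: algebra_simps)
  ultimately have "p dvd ?F - [:w / d:]" using not_dvd_const[OF \<open>d \<noteq> 0\<close>]
    by (metis prime_elem_dvd_multD[OF prime])
  then have "?F mod p = [:w / d:] mod p"
    by (simp add: mod_eq_0_iff_dvd[symmetric] poly_mod_diff_left)
  also have "\<dots> = [:w / d:]" using deg by (simp add: mod_poly_less)
  finally show thesis using that[of "w / d"] \<open>d \<noteq> 0\<close> \<open>w \<noteq> 0\<close> by simp
qed

end

section \<open>Evaluation codes\<close>

text \<open>All blocks have the same length \<open>k\<close>, so the concatenation can be indexed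
  directly: \<open>i div k\<close> selects the place and \<open>i mod k\<close> the evaluation
  point.\<close>

lemma gag_code_eq:
  fixes ps :: "'a::field poly list"
  assumes "length \<alpha>s = k"
  shows "gag_code ps m (replicate (length ps) (rs_encode \<alpha>s)) =
    (\<lambda>f. vec (k * length ps) (\<lambda>i. poly (f mod ps ! (i div k)) (\<alpha>s ! (i mod k)))) ` {f. degree f \<le> m}"
proof -
  have "vec_of_list (concat (map2 (\<lambda>p \<pi>. \<pi> (f mod p)) ps (replicate (length ps) (rs_encode \<alpha>s)))) =
      vec (k * length ps) (\<lambda>i. poly (f mod ps ! (i div k)) (\<alpha>s ! (i mod k)))" for f
  proof -
    have map: "map2 (\<lambda>p \<pi>. \<pi> (f mod p)) ps (replicate (length ps) (rs_encode \<alpha>s)) =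
        map (\<lambda>p. rs_encode \<alpha>s (f mod p)) ps"
      by (rule nth_equalityI) auto
    have len: "length (concat (map (\<lambda>p. rs_encode \<alpha>s (f mod p)) ps)) = k * length ps"
      using assms by (induction ps) (auto simp: rs_encode_def)
    have "concat (map (\<lambda>p. rs_encode \<alpha>s (f mod p)) ps) ! i = poly (f mod ps ! (i div k)) (\<alpha>s ! (i mod k))"
      if "i < k * length ps" for i
      using that
    proof (induction ps arbitrary: i)
      case (Cons p ps)
      show ?case
      proof (cases "i < k")
        case True
        then show ?thesis using assms by (simp add: nth_append rs_encode_def)
      next
        case False
        have "k > 0" using Cons.prems by (cases k) auto
        with False have "i div k = Suc ((i - k) div k)" "i mod k = (i - k) mod k"
          by (auto simp: le_div_geq le_mod_geq)
        with False Cons show ?thesis using assms by (simp add: nth_append rs_encode_def)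
      qed
    qed simp
    then show ?thesis unfolding map
      by (intro eq_vecI) (auto simp: len vec_of_list_index)
  qed
  then show ?thesis unfolding gag_code_def by (simp only: setcompr_eq_image)
qed

text \<open>Polynomials of degree at most \<open>m\<close> are parametrised by their coefficient vectors, so that
  rank-nullity applies.\<close>

lemma linear_evaluation_code:
  fixes E :: "'a::field poly \<Rightarrow> 'a vec"
  assumes dim: "\<And>f. dim_vec (E f) = n"
    and add: "\<And>f g. E (f + g) = E f + E g"
    and scale: "\<And>c f. E (Polynomial.smult c f) = c \<cdot>\<^sub>v E f"
    and inj: "\<And>f. degree f \<le> m \<Longrightarrow> E f = 0\<^sub>v n \<Longrightarrow> f = 0"
  shows "linear_code n (E ` {f. degree f \<le> m})"
    and "code_dim n (E ` {f. degree f \<le> m}) = Suc m"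
proof -
  \<comment> \<open>A polynomial of degree at most \<open>m\<close> has \<open>Suc m\<close>
    coefficients; \<open>P\<close> rebuilds it from them, and the code becomes the image of the
    linear map \<open>E \<circ> P\<close>.\<close>
  define P where "P v = (\<Sum>i<Suc m. monom (v $ i) i)" for v :: "'a vec"
  let ?V = "module_vec TYPE('a) (Suc m)" and ?W = "module_vec TYPE('a) n"
  have coeff: "coeff (P v) i = (if i \<le> m then v $ i else 0)" for v i
    unfolding P_def by (auto simp: coeff_sum less_Suc_eq_le)
  have deg: "degree (P v) \<le> m" for v
    by (rule degree_le) (simp add: coeff)
  have img: "P ` carrier_vec (Suc m) = {f. degree f \<le> m}"
  proof (intro equalityI subsetI)
    fix f :: "'a poly" assume "f \<in> {f. degree f \<le> m}"
    then have "f = P (vec (Suc m) (coeff f))"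
      by (intro poly_eqI) (auto simp: coeff coeff_eq_0)
    then show "f \<in> P ` carrier_vec (Suc m)" by (rule image_eqI) simp
  qed (use deg in auto)
  have P_add: "P (v + w) = P v + P w" if "v \<in> carrier_vec (Suc m)" "w \<in> carrier_vec (Suc m)" for v w
    using that by (intro poly_eqI) (auto simp: coeff)
  have P_scale: "P (c \<cdot>\<^sub>v v) = Polynomial.smult c (P v)" if "v \<in> carrier_vec (Suc m)" for v c
    using that by (intro poly_eqI) (auto simp: coeff)
  have lm: "linear_map class_ring ?V ?W (E \<circ> P)"
    unfolding linear_map_def mod_hom_def mod_hom_axioms_def LinearCombinations.module_hom_def
    by (auto simp: vec_vs vec_module module_vec_simps P_add P_scale add scale dim intro!: carrier_vecI)
  interpret linear_map class_ring ?V ?W "E \<circ> P" by (rule lm)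
  have code: "E ` {f. degree f \<le> m} = imT"
    unfolding im_def img[symmetric] by (simp add: module_vec_simps image_comp)
  show "linear_code n (E ` {f. degree f \<le> m})"
    unfolding linear_code_def code by (rule imT_is_subspace)
  \<comment> \<open>A trivial kernel has dimension 0, so rank-nullity gives the image the full
    dimension \<open>Suc m\<close>.\<close>
  have ker: "carrier (V.vs kerT) = {\<zero>\<^bsub>?V\<^esub>}"
  proof -
    have "v = 0\<^sub>v (Suc m)" if "v \<in> carrier_vec (Suc m)" "E (P v) = 0\<^sub>v n" for v
    proof -
      have "P v = 0" using inj deg that(2) by blast
      then have "v $ i = 0" if "i \<le> m" for i using coeff[of v i] that by simp
      then show ?thesis using that(1) by (intro eq_vecI) auto
    qed
    moreover have "E (P (0\<^sub>v (Suc m))) = 0\<^sub>v n"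
      using f0_is_0 by (simp add: module_vec_simps)
    ultimately show ?thesis unfolding ker_def by (auto simp: module_vec_simps)
  qed
  have "V.dim = Suc m" by (rule vec_space.dim_is_n)
  moreover have "V.fin_dim" by (rule vec_space.fin_dim)
  ultimately show "code_dim n (E ` {f. degree f \<le> m}) = Suc m"
    using rank_nullity inj_imp_dim_ker0[OF Ke0_imp_inj[OF ker]]
    unfolding code_dim_def code by simp
qed

lemma linear_poly_two_roots:
  fixes h :: "'a::field poly"
  assumes "h = 0 \<or> degree h < 2" "poly h a = 0" "poly h b = 0" "a \<noteq> b"
  shows "h = 0"
proof (rule ccontr)
  assume "h \<noteq> 0"
  have "card {a, b} \<le> card {x. poly h x = 0}"
    using assms poly_roots_finite[OF \<open>h \<noteq> 0\<close>] by (intro card_mono) auto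
  also have "\<dots> \<le> degree h" using \<open>h \<noteq> 0\<close> by (rule card_poly_roots_bound)
  finally show False using assms \<open>h \<noteq> 0\<close> by simp
qed

section \<open>Parameters of the code\<close>

context
  fixes ps :: "'a::{field,finite} poly list" and \<alpha>s :: "'a list"
  assumes card: "CARD('a) \<ge> 3"
    and dist: "distinct ps" and set: "set ps = places_of_degree 2"
    and len: "length \<alpha>s = 3" and dist': "distinct \<alpha>s"
begin

private abbreviation (input) t where "t \<equiv> length ps"

private definition E :: "'a poly \<Rightarrow> 'a vec" where
  "E f = vec (3 * t) (\<lambda>i. poly (f mod ps ! (i div 3)) (\<alpha>s ! (i mod 3)))"

text \<open>The bound \<open>2 * t - 2\<close> equals q^2 - q - 2 by
  \<open>two_t_eq\<close>.\<close>

private abbreviation (input) \<C> :: "'a vec set" where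
  "\<C> \<equiv> E ` {f. degree f \<le> 2 * t - 2}"

private lemma t_eq: "t = (CARD('a)^2 - CARD('a)) div 2"
  using card_places_of_degree_2[where 'a='a] distinct_card[OF dist] set by simp

private lemma two_t_eq: "2 * t = CARD('a)^2 - CARD('a)"
proof -
  have "CARD('a)^2 - CARD('a) = CARD('a) * (CARD('a) - 1)"
    by (simp add: power2_eq_square right_diff_distrib')
  then show ?thesis unfolding t_eq by simp
qed

text \<open>This is where q >= 3 enters; it keeps the natural-number subtractions
  \<open>2 * t - 2\<close> and \<open>2 * t - 1\<close> from truncating.\<close>

private lemma t_ge: "t \<ge> 3"
proof -
  have "3 * 2 \<le> CARD('a) * (CARD('a) - 1)" using card by (intro mult_le_mono) auto
  then show ?thesis using two_t_eq by (simp add: power2_eq_square right_diff_distrib')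
qed

private lemma place:
  assumes "a < t"
  shows "lead_coeff (ps ! a) = 1" "irreducible (ps ! a)" "degree (ps ! a) = 2" "ps ! a \<noteq> 0"
  using nth_mem[OF assms] unfolding set places_of_degree_def by auto

private lemma residue_degree: "a < t \<Longrightarrow> f mod ps ! a = 0 \<or> degree (f mod ps ! a) < 2"
  using degree_mod_less[OF place(4), of a f] place(3) by simp

private lemma E_index: "a < t \<Longrightarrow> j < 3 \<Longrightarrow> E f $ (3 * a + j) = poly (f mod ps ! a) (\<alpha>s ! j)"
  by (simp add: E_def)

private lemma dim_E: "dim_vec (E f) = 3 * t"
  by (simp add: E_def)

private lemma E_add: "E (f + g) = E f + E g"
  by (rule eq_vecI) (auto simp: E_def poly_mod_add_left)

private lemma E_scale: "E (Polynomial.smult c f) = c \<cdot>\<^sub>v E f"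
  by (rule eq_vecI) (auto simp: E_def mod_smult_left)

private lemma E_diff: "E (f - g) = E f - E g"
  by (rule eq_vecI) (auto simp: E_def poly_mod_diff_left)

private lemma alpha_eq_iff: "i < 3 \<Longrightarrow> j < 3 \<Longrightarrow> \<alpha>s ! i = \<alpha>s ! j \<longleftrightarrow> i = j"
  using dist' len by (simp add: nth_eq_iff_index_eq)

text \<open>Two of the three values determine a remainder of degree less than 2. This yields both
  the weight of at least 2 per nonzero block and the locality.\<close>

private lemma residue_eq_0:
  assumes "a < t" "i < 3" "j < 3" "i \<noteq> j" "poly (f mod ps ! a) (\<alpha>s ! i) = 0" "poly (f mod ps ! a) (\<alpha>s ! j) = 0"
  shows "f mod ps ! a = 0"
  using linear_poly_two_roots[OF residue_degree[OF assms(1)] assms(5,6)] assms alpha_eq_iff by simp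

private lemma prod_others_dvd:
  assumes "\<And>b. b < t \<Longrightarrow> b \<noteq> a \<Longrightarrow> f mod ps ! b = 0"
  shows "\<Prod>(set ps - {ps ! a}) dvd f"
proof (rule prod_monic_irreducible_dvd)
  fix p assume "p \<in> set ps - {ps ! a}"
  then obtain b where "b < t" "p = ps ! b" "b \<noteq> a" by (auto simp: in_set_conv_nth)
  then show "lead_coeff p = 1 \<and> irreducible p \<and> p dvd f"
    using place assms by (auto simp: mod_eq_0_iff_dvd)
qed simp

private lemma degree_prod_places: "S \<subseteq> set ps \<Longrightarrow> degree (\<Prod>S) = 2 * card S"
  using set by (subst degree_prod_eq_sum_degree)
    (auto simp: places_of_degree_def subset_eq irreducible_def intro!: trans[OF sum.cong])

private lemma card_others: "a < t \<Longrightarrow> card (set ps - {ps ! a}) = t - 1"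
  using distinct_card[OF dist] by (simp add: card_Diff_singleton)

text \<open>Otherwise \<open>f\<close> would be a nonzero multiple of the product of all places,
  whose degree \<open>2 * t\<close> exceeds the bound.\<close>

private lemma all_residues_0:
  assumes "degree f \<le> 2 * t - 2" "\<And>b. b < t \<Longrightarrow> f mod ps ! b = 0"
  shows "f = 0"
proof (rule ccontr)
  assume "f \<noteq> 0"
  have "\<Prod>(set ps) dvd f"
    using assms(2) place by (intro prod_monic_irreducible_dvd) (auto simp: in_set_conv_nth mod_eq_0_iff_dvd)
  then have "degree (\<Prod>(set ps)) \<le> degree f" using \<open>f \<noteq> 0\<close> by (rule dvd_imp_degree_le)
  then show False using assms(1) degree_prod_places[of "set ps"] distinct_card[OF dist] t_ge by simp
qed

text \<open>The other \<open>t - 1\<close> places already use up the whole degree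
  \<open>2 * t - 2\<close>, so the cofactor \<open>h\<close> is a scalar and
  \<open>prod_other_places_const\<close> applies.\<close>

private lemma single_residue_const:
  assumes "degree f \<le> 2 * t - 2" "f \<noteq> 0" "a < t" "\<And>b. b < t \<Longrightarrow> b \<noteq> a \<Longrightarrow> f mod ps ! b = 0"
  obtains c where "c \<noteq> 0" "f mod ps ! a = [:c:]"
proof -
  let ?F = "\<Prod>(set ps - {ps ! a})"
  obtain h where h: "f = ?F * h" using prod_others_dvd[OF assms(4)] by (auto simp: dvd_def)
  then have "?F \<noteq> 0" "h \<noteq> 0" using assms(2) by auto
  then have "degree f = 2 * (t - 1) + degree h"
    using degree_prod_places[of "set ps - {ps ! a}"] card_others[OF assms(3)] unfolding h
    by (simp add: degree_mult_eq)
  with assms(1) t_ge have "degree h = 0" by simp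
  then obtain d where d: "h = [:d:]" by (rule degree_eq_zeroE)
  obtain c where c: "c \<noteq> 0" "?F mod ps ! a = [:c:]"
    using prod_other_places_const[of "ps ! a"] place[OF assms(3)] unfolding set by metis
  have "f mod ps ! a = [:d * c:]" unfolding h d using c by (simp add: mod_smult_left)
  moreover have "d * c \<noteq> 0" using c d \<open>h \<noteq> 0\<close> by auto
  ultimately show thesis using that by blast
qed

private lemma two_nonroots:
  assumes "a < t" "f mod ps ! a \<noteq> 0"
  shows "card {j. j < 3 \<and> poly (f mod ps ! a) (\<alpha>s ! j) \<noteq> 0} \<ge> 2"
proof -
  let ?Z = "{j. j < 3 \<and> poly (f mod ps ! a) (\<alpha>s ! j) = 0}"
  have "card ?Z \<le> 1"
    using residue_eq_0[OF assms(1)] assms(2) by (auto simp: card_le_Suc0_iff_eq One_nat_def)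
  moreover have "{j. j < 3 \<and> poly (f mod ps ! a) (\<alpha>s ! j) \<noteq> 0} = {..<3} - ?Z" by auto
  moreover have "card ({..<3} - ?Z) = 3 - card ?Z" by (subst card_Diff_subset) auto
  ultimately show ?thesis by simp
qed

section \<open>Codeword weights, minimum distance and locality\<close>

private definition support :: "'a poly \<Rightarrow> nat set" where
  "support f = {i. i < 3 * t \<and> E f $ i \<noteq> 0}"

private lemma hamming_dist_E: "hamming_dist (E f) (E g) = card (support (f - g))"
proof -
  have "{i. i < dim_vec (E f) \<and> E f $ i \<noteq> E g $ i} = support (f - g)"
    by (auto simp: support_def E_diff dim_E)
  then show ?thesis by (simp add: hamming_dist_def)
qed

private lemma block_subset_support:
  "a < t \<Longrightarrow> (\<lambda>j. 3 * a + j) ` {j. j < 3 \<and> poly (f mod ps ! a) (\<alpha>s ! j) \<noteq> 0} \<subseteq> support f"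
  using E_index by (auto simp: support_def)

private lemma card_support_ge:
  assumes "degree f \<le> 2 * t - 2" "f \<noteq> 0"
  shows "card (support f) \<ge> 3"
proof -
  let ?N = "\<lambda>a. {j. j < 3 \<and> poly (f mod ps ! a) (\<alpha>s ! j) \<noteq> 0}"
  let ?B = "\<lambda>a. (\<lambda>j. 3 * a + j) ` ?N a"
  have card_B: "card (?B a) = card (?N a)" for a by (rule card_image) (auto simp: inj_on_def)
  have fin: "finite (support f)" by (simp add: support_def)
  obtain a where a: "a < t" "f mod ps ! a \<noteq> 0" using all_residues_0[OF assms(1)] assms(2) by blast
  show ?thesis
  \<comment> \<open>Two nonzero blocks are disjoint and contribute at least 2 + 2. A single one
    holds a nonzero constant, which is nonzero at all three evaluation points.\<close>
  proof (cases "\<exists>b<t. b \<noteq> a \<and> f mod ps ! b \<noteq> 0")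
    case True
    then obtain b where b: "b < t" "b \<noteq> a" "f mod ps ! b \<noteq> 0" by blast
    have "?B a \<inter> ?B b = {}" using b(2) by auto
    then have "card (?B a \<union> ?B b) = card (?N a) + card (?N b)"
      using card_B by (subst card_Un_disjoint) auto
    moreover have "card (?B a \<union> ?B b) \<le> card (support f)"
      using block_subset_support a b fin by (intro card_mono) auto
    ultimately show ?thesis using two_nonroots[OF a] two_nonroots[OF b(1,3)] by linarith
  next
    case False
    then obtain c where "c \<noteq> 0" "f mod ps ! a = [:c:]"
      using single_residue_const[OF assms a(1)] by blast
    then have "?N a = {..<3}" by auto
    then have "card (?B a) = 3" using card_B[of a] by simp
    moreover have "card (?B a) \<le> card (support f)"
      using block_subset_support a fin by (intro card_mono) auto
    ultimately show ?thesis by simp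
  qed
qed

text \<open>The product of all places but the first vanishes on every block except the first, which
  has three coordinates, and its degree is exactly the permitted maximum.\<close>

private lemma weight_3_codeword:
  obtains f where "degree f \<le> 2 * t - 2" "f \<noteq> 0" "card (support f) \<le> 3"
proof -
  let ?f = "\<Prod>(set ps - {ps ! 0})"
  have t0: "0 < t" using t_ge by linarith
  have "0 \<notin> set ps" unfolding set by (simp add: places_of_degree_def)
  then have "?f \<noteq> 0" by auto
  moreover have "degree ?f \<le> 2 * t - 2"
    using degree_prod_places[of "set ps - {ps ! 0}"] card_others[OF t0] by auto
  moreover have "support ?f \<subseteq> {..<3}"
  proof
    fix i assume i: "i \<in> support ?f"
    show "i \<in> {..<3}"
    proof (rule ccontr)
      assume "i \<notin> {..<3}"
      then have b: "i div 3 < t" "i div 3 \<noteq> 0" using i by (auto simp: support_def)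
      then have "ps ! (i div 3) \<in> set ps - {ps ! 0}" using dist t0 by (auto simp: nth_eq_iff_index_eq)
      then have "ps ! (i div 3) dvd ?f" by (rule dvd_prodI[rotated]) simp
      then have "?f mod ps ! (i div 3) = 0" by (rule dvd_imp_mod_0)
      with i show False by (auto simp: support_def E_def)
    qed
  qed
  then have "card (support ?f) \<le> card {..<3::nat}" by (rule card_mono[OF finite_lessThan])
  then have "card (support ?f) \<le> 3" by simp
  ultimately show thesis using that[of ?f] by blast
qed

private lemma min_dist_code: "min_dist \<C> = 3"
proof -
  let ?D = "{hamming_dist u v | u v. u \<in> \<C> \<and> v \<in> \<C> \<and> u \<noteq> v}"
  have ge: "d \<ge> 3" if "d \<in> ?D" for d
  proof -
    from that obtain f g where fg: "degree f \<le> 2 * t - 2" "degree g \<le> 2 * t - 2" "E f \<noteq> E g"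
      "d = hamming_dist (E f) (E g)" by auto
    then have "f - g \<noteq> 0" by auto
    moreover have "degree (f - g) \<le> 2 * t - 2" using fg by (intro degree_diff_le)
    ultimately show ?thesis using card_support_ge fg(4) hamming_dist_E by simp
  qed
  \<comment> \<open>Distances are bounded by the length, which makes the set of distances finite, as
    \<open>Min\<close> requires.\<close>
  have "hamming_dist u v \<le> 3 * t" if "u \<in> \<C>" "v \<in> \<C>" for u v
  proof -
    have "card {i. i < 3 * t \<and> u $ i \<noteq> v $ i} \<le> card {..<3 * t}" by (intro card_mono) auto
    moreover have "dim_vec u = 3 * t" using that(1) dim_E by auto
    ultimately show ?thesis by (simp add: hamming_dist_def)
  qed
  then have "?D \<subseteq> {..3 * t}" by auto
  then have fin: "finite ?D" by (rule finite_subset) simp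
  obtain f where f: "degree f \<le> 2 * t - 2" "f \<noteq> 0" "card (support f) \<le> 3"
    by (rule weight_3_codeword)
  have "card (support f) = 3" using f card_support_ge[OF f(1,2)] by simp
  moreover have "E f \<noteq> E 0"
  proof
    assume "E f = E 0"
    then have "hamming_dist (E f) (E 0) = 0" by (simp only: hamming_dist_def) simp
    then show False using hamming_dist_E[of f 0] \<open>card (support f) = 3\<close> by simp
  qed
  moreover have "E f \<in> \<C>" "E 0 \<in> \<C>" using f(1) by auto
  moreover have "hamming_dist (E f) (E 0) = card (support f)" using hamming_dist_E[of f 0] by simp
  ultimately have "3 \<in> ?D" by (metis (mono_tags, lifting) mem_Collect_eq)
  then show ?thesis unfolding min_dist_def by (intro Min_eqI fin ge)
qed

text \<open>The recovery set of a coordinate consists of the other two coordinates of its block: two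
  evaluations determine the linear remainder and therefore its third value.\<close>

private lemma locality_code: "has_locality (3 * t) \<C> 2"
  unfolding has_locality_def
proof (intro allI impI)
  fix i assume i: "i < 3 * t"
  define a where "a = i div 3"
  define N where "N = (\<lambda>j. 3 * a + j) ` ({..<3} - {i mod 3})"
  have a: "a < t" using i by (simp add: a_def)
  have i_eq: "i = 3 * a + i mod 3" by (simp add: a_def)
  have "N \<subseteq> {..<3 * t} - {i}"
  proof
    fix k assume "k \<in> N"
    then obtain j where "k = 3 * a + j" "j < 3" "j \<noteq> i mod 3" by (auto simp: N_def)
    then show "k \<in> {..<3 * t} - {i}" using a i_eq by auto
  qed
  moreover have "card N \<le> 2"
  proof -
    have "card N \<le> card ({..<3} - {i mod 3})" unfolding N_def by (rule card_image_le) simp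
    also have "\<dots> = 2" by (simp add: card_Diff_singleton)
    finally show ?thesis .
  qed
  moreover have "E f $ i = E g $ i" if N: "\<forall>k\<in>N. E f $ k = E g $ k" for f g
  proof -
    \<comment> \<open>Passing to the difference turns agreement on \<open>N\<close> into two roots
      of one remainder.\<close>
    let ?h = "(f - g) mod ps ! a"
    have 0: "poly ?h (\<alpha>s ! j) = 0" if "j < 3" "j \<noteq> i mod 3" for j
    proof -
      have "E f $ (3 * a + j) = E g $ (3 * a + j)" using N that by (auto simp: N_def)
      then show ?thesis using E_index[OF a that(1)] by (simp add: poly_mod_diff_left)
    qed
    have "\<exists>j k. j < 3 \<and> k < 3 \<and> j \<noteq> k \<and> j \<noteq> i mod 3 \<and> k \<noteq> (i mod 3 :: nat)"
    proof -
      have "i mod 3 = 0 \<or> i mod 3 = 1 \<or> i mod 3 = 2" by linarith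
      then show ?thesis
        by (elim disjE) (rule exI[of _ 1] exI[of _ 0], rule exI[of _ 2] exI[of _ 1], simp)+
    qed
    then obtain j k where "j < 3" "k < 3" "j \<noteq> k" "j \<noteq> i mod 3" "k \<noteq> i mod 3" by blast
    then have "?h = 0" using residue_eq_0[OF a] 0 by blast
    then have "f mod ps ! a = g mod ps ! a" by (simp add: poly_mod_diff_left)
    then show ?thesis using E_index[OF a, of "i mod 3"] i_eq by simp
  qed
  ultimately show "\<exists>N\<subseteq>{..<3 * t} - {i}. card N \<le> 2 \<and>
      (\<forall>c\<in>\<C>. \<forall>c'\<in>\<C>. (\<forall>j\<in>N. c $ j = c' $ j) \<longrightarrow> c $ i = c' $ i)"
    by blast
qed

text \<open>The weight bound also gives injectivity of the encoding, the hypothesis from which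
  \<open>linear_evaluation_code\<close> obtains the dimension.\<close>

private lemma E_eq_0_imp:
  assumes "degree f \<le> 2 * t - 2" "E f = 0\<^sub>v (3 * t)"
  shows "f = 0"
proof (rule ccontr)
  assume "f \<noteq> 0"
  have "support f = {}" using assms(2) by (simp add: support_def)
  then show False using card_support_ge[OF assms(1) \<open>f \<noteq> 0\<close>] by simp
qed

lemma gag_code_parameters:
  defines "\<D> \<equiv> gag_code ps (2 * t - 2) (replicate t (rs_encode \<alpha>s))"
  shows "2 * t = CARD('a)^2 - CARD('a)" "t \<ge> 3" "linear_code (3 * t) \<D>" "code_dim (3 * t) \<D> = 2 * t - 1"
    "min_dist \<D> = 3" "has_locality (3 * t) \<D> 2"
proof -
  have D: "\<D> = \<C>" unfolding \<D>_def gag_code_eq[OF len] E_def ..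
  show "linear_code (3 * t) \<D>"
    unfolding D by (rule linear_evaluation_code(1)[OF dim_E E_add E_scale E_eq_0_imp])
  have "code_dim (3 * t) \<D> = Suc (2 * t - 2)"
    unfolding D by (rule linear_evaluation_code(2)[OF dim_E E_add E_scale E_eq_0_imp])
  then show "code_dim (3 * t) \<D> = 2 * t - 1" using t_ge by simp
qed (use two_t_eq t_ge min_dist_code locality_code in
      \<open>simp_all add: \<D>_def gag_code_eq[OF len] E_def[abs_def]\<close>)

end

theorem proposition4p3:
  fixes ps :: "'a::{field,finite} poly list" and \<alpha>s :: "'a list" and q :: nat
  assumes "q = card (UNIV :: 'a set)" and "q \<ge> 3"
    and "distinct ps" and "set ps = places_of_degree 2"
    and "length \<alpha>s = 3" and "distinct \<alpha>s"
  shows "let n = 3 * (q^2 - q) div 2;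
             r = 2;
             C = gag_code ps (q^2 - q - 2) (replicate (length ps) (rs_encode \<alpha>s))
         in length ps = (q^2 - q) div 2 \<and>
            linear_code n C \<and>
            code_dim n C = q^2 - q - 1 \<and>
            min_dist C = 3 \<and>
            has_locality n C r \<and>
            int (min_dist C) = int n - int (code_dim n C) - \<lceil>real (code_dim n C) / real r\<rceil> + 2"
proof -
  define t where "t = length ps"
  note par = gag_code_parameters[OF assms(2)[unfolded assms(1)] assms(3-6), folded t_def]
  have q: "q^2 - q = 2 * t" using par(1) assms(1) by simp
  have n: "3 * (2 * t) div 2 = 3 * t" by simp
  \<comment> \<open>The quotient is t - 1/2, which rounds up to t, so the right side of the bound is
    3t - (2t - 1) - t + 2 = 3.\<close>
  have "\<lceil>real (2 * t - 1) / 2\<rceil> = int t"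
    using par(2) by (intro ceiling_unique) (auto simp: of_nat_diff field_simps)
  then have "int 3 = int (3 * t) - int (2 * t - 1) - \<lceil>real (2 * t - 1) / real 2\<rceil> + 2"
    using par(2) by simp
  then show ?thesis
    unfolding Let_def q n t_def[symmetric] par(4,5) using par(3,6) by simp
qed

end
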